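(* For every integer $n\ge 1$, if $\sigma$ is chosen uniformly at random from $M_n$, then the expected value of the position $f(\sigma)$ of the first match is $$\frac{2^{2n}}{\binom{2n}{n}}.$$
   Context: For $n\ge1$, $M_n$ denotes the set of standard permutations (deals) of the multiset $\{1,1,2,2,\dots,n,n\}$: functions $\sigma:\{1,\dots,2n\}\to\{1,\dots,n\}$ taking each value exactly twice and such that, for each $1\le i\le n-1$, the second occurrence of $i$ in the sequence $\sigma(1),\dots,\sigma(2n)$ is to the left of the second occurrence of $i+1$. For $\sigma\in M_n$, $f(\sigma)$ (the position of the first match) is the smallest index $j$ such that $\sigma(j)=\sigma(i)$ for some $i<j$. *)

theory Defs
  imports "HOL-Probability.Probability"
begin

text \<open>
  Sequences \<open>\<sigma>(1), \<dots>, \<sigma>(2n)\<close> are functions on \<open>{1..2*n}\<close>, made canonical by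
  \<open>undefined\<close> outside that interval, so that each sequence is counted once.
\<close>

definition second_occurrence :: "nat \<Rightarrow> (nat \<Rightarrow> nat) \<Rightarrow> nat \<Rightarrow> nat" where
  "second_occurrence n \<sigma> i =
     (LEAST j. j \<in> {1..2*n} \<and> \<sigma> j = i \<and> (\<exists>k\<in>{1..<j}. \<sigma> k = i))"

definition standard_deals :: "nat \<Rightarrow> (nat \<Rightarrow> nat) set" where
  "standard_deals n =
     {\<sigma> \<in> {1..2*n} \<rightarrow>\<^sub>E {1..n}.
        (\<forall>i\<in>{1..n}. card {j \<in> {1..2*n}. \<sigma> j = i} = 2) \<and>
        (\<forall>i\<in>{1..<n}. second_occurrence n \<sigma> i < second_occurrence n \<sigma> (i + 1))}"

definition first_match :: "nat \<Rightarrow> (nat \<Rightarrow> nat) \<Rightarrow> nat" where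
  "first_match n \<sigma> = (LEAST j. j \<in> {1..2*n} \<and> (\<exists>i\<in>{1..<j}. \<sigma> j = \<sigma> i))"

text \<open>
  The next two facts ensure that \<open>pmf_of_set (standard_deals n)\<close> is the uniform distribution.
\<close>

lemma finite_standard_deals: "finite (standard_deals n)"
  by (rule finite_subset[of _ "{1..2*n} \<rightarrow>\<^sub>E {1..n}"])
     (auto simp: standard_deals_def intro: finite_PiE)

lemma standard_deals_nonempty: "standard_deals n \<noteq> {}"
proof -
  define \<sigma> where "\<sigma> = (\<lambda>j\<in>{1..2*n}. (j + 1) div 2)"
  have val: "\<sigma> j = (j + 1) div 2" if "j \<in> {1..2*n}" for j
    using that by (simp add: \<sigma>_def)
  have fib: "{j \<in> {1..2*n}. \<sigma> j = i} = {2*i - 1, 2*i}" if i: "i \<in> {1..n}" for i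
  proof (rule set_eqI)
    fix j
    have "(j \<in> {1..2*n} \<and> (j + 1) div 2 = i) = (j = 2*i - 1 \<or> j = 2*i)"
      using i by auto
    then show "(j \<in> {j \<in> {1..2*n}. \<sigma> j = i}) = (j \<in> {2*i - 1, 2*i})"
      using val[of j] by auto
  qed
  have second: "second_occurrence n \<sigma> i = 2*i" if i: "i \<in> {1..n}" for i
    unfolding second_occurrence_def
  proof (rule Least_equality)
    have "\<sigma> (2*i) = i" "\<sigma> (2*i - 1) = i"
      using i fib[OF i] by blast+
    moreover have "2*i - 1 \<in> {1..<2*i}" "2*i \<in> {1..2*n}"
      using i by auto
    ultimately show "2*i \<in> {1..2*n} \<and> \<sigma> (2*i) = i \<and> (\<exists>k\<in>{1..<2*i}. \<sigma> k = i)"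
      by blast
  next
    fix j assume j: "j \<in> {1..2*n} \<and> \<sigma> j = i \<and> (\<exists>k\<in>{1..<j}. \<sigma> k = i)"
    then obtain k where k: "k \<in> {1..<j}" "\<sigma> k = i" by blast
    with j have "k \<in> {1..2*n}" by auto
    with k j have "(k + 1) div 2 = i" "(j + 1) div 2 = i" "k < j"
      using val[of k] val[of j] by auto
    then show "2*i \<le> j" by linarith
  qed
  have "\<sigma> \<in> {1..2*n} \<rightarrow>\<^sub>E {1..n}"
    by (auto simp: \<sigma>_def)
  moreover have "card {j \<in> {1..2*n}. \<sigma> j = i} = 2" if i: "i \<in> {1..n}" for i
  proof -
    have "2*i - 1 \<noteq> 2*i" using i by auto
    then show ?thesis by (simp only: fib[OF i] card_2_iff) blast
  qed
  moreover have "second_occurrence n \<sigma> i < second_occurrence n \<sigma> (i + 1)" if "i \<in> {1..<n}" for i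
    using second[of i] second[of "i + 1"] that by simp
  ultimately have "\<sigma> \<in> standard_deals n"
    by (simp add: standard_deals_def)
  then show ?thesis by blast
qed

end

theory Submission
  imports Defs
begin

text \<open>
  The last card of a standard deal is the second \<open>n + 1\<close>. Deleting it together with the first
  \<open>n + 1\<close>, at position \<open>p\<close>, gives a bijection between the deals of size \<open>n + 1\<close> and the pairs of
  a deal \<open>\<tau>\<close> of size \<open>n\<close> and a position \<open>p \<in> {1..2n+1}\<close>. If \<open>\<tau>\<close> has its first match at \<open>m\<close>,
  reinserting the pair moves it to \<open>m + 1\<close> if \<open>p \<le> m\<close> and leaves it at \<open>m\<close> otherwise, so the
  first matches sum to \<open>m (m + 1) + (2n + 1 - m) m = 2 (n + 1) m\<close> over \<open>p\<close>. Hence the total of the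
  first matches is \<open>2\<^sup>n n!\<close>, whereas there are \<open>(2n)! / (2\<^sup>n n!)\<close> deals.
\<close>

section \<open>Making room for an inserted pair of positions\<close>

text \<open>The increasing enumeration of the naturals other than \<open>p\<close>: it sends a
  position of the short deal to its position in the long one, so comparisons of positions transfer
  by monotonicity.\<close>

definition skip :: "nat \<Rightarrow> nat \<Rightarrow> nat" where
  "skip p j = (if j < p then j else Suc j)"

text \<open>The arguments \<open>j\<close> and \<open>j - 1\<close> of \<open>\<tau>\<close> are the
  preimages of \<open>j\<close> under \<open>skip p\<close>. The restriction makes the result
  \<open>undefined\<close> off the interval, as membership in \<open>standard_deals\<close>
  demands.\<close>

definition insert_pair :: "nat \<Rightarrow> (nat \<Rightarrow> nat) \<Rightarrow> nat \<Rightarrow> nat \<Rightarrow> nat" where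
  "insert_pair n \<tau> p =
     (\<lambda>j\<in>{1..2 * Suc n}. if j = p \<or> j = 2 * Suc n then Suc n
                         else if j < p then \<tau> j else \<tau> (j - 1))"

lemma strict_mono_skip: "strict_mono (skip p)"
  by (auto simp: strict_mono_def skip_def)

lemmas skip_less_iff [simp] = strict_mono_less [OF strict_mono_skip]
lemmas skip_le_iff [simp] = strict_mono_less_eq [OF strict_mono_skip]

lemma skip_image:
  assumes "p \<in> {1..2 * n + 1}"
  shows "skip p ` {1..2 * n} = {1..2 * Suc n} - {p, 2 * Suc n}"
proof (intro equalityI subsetI)
  fix j assume j: "j \<in> {1..2 * Suc n} - {p, 2 * Suc n}"
  show "j \<in> skip p ` {1..2 * n}"
  proof (cases "j < p")
    case True
    with j assms show ?thesis by (intro image_eqI[of _ _ j]) (auto simp: skip_def)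
  next
    case False
    with j assms show ?thesis by (intro image_eqI[of _ _ "j - 1"]) (auto simp: skip_def)
  qed
qed (use assms in \<open>auto simp: skip_def\<close>)

lemma sum_skip:
  assumes "m \<le> 2 * n + 1"
  shows "(\<Sum>p\<in>{1..2 * n + 1}. skip p m) = 2 * Suc n * m"
proof -
  \<comment> \<open>The shift is the indicator of \<open>p \<le> m\<close>. The bound on
    \<open>m\<close> keeps all \<open>m\<close> such positions inside the range of
    summation.\<close>
  have "(\<Sum>p\<in>{1..2 * n + 1}. skip p m) = (\<Sum>p\<in>{1..2 * n + 1}. m + (if p \<in> {1..m} then 1 else 0))"
    by (intro sum.cong) (auto simp: skip_def)
  also have "\<dots> = (2 * n + 1) * m + card ({1..2 * n + 1} \<inter> {1..m})"
    unfolding sum.distrib card_eq_sum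
    by (subst sum.inter_restrict) (simp_all del: sum.cl_ivl_Suc)
  also have "{1..2 * n + 1} \<inter> {1..m} = {1..m}"
    using assms by auto
  finally show ?thesis by simp
qed

lemma insert_pair_skip:
  assumes "p \<in> {1..2 * n + 1}" "j \<in> {1..2 * n}"
  shows "insert_pair n \<tau> p (skip p j) = \<tau> j"
  using assms by (auto simp: insert_pair_def skip_def)

lemma insert_pair_new:
  assumes "p \<in> {1..2 * n + 1}"
  shows "insert_pair n \<tau> p p = Suc n" "insert_pair n \<tau> p (2 * Suc n) = Suc n"
  using assms by (auto simp: insert_pair_def)

text \<open>The elimination form of \<open>skip_image\<close>, along which the pointwise arguments
  about long deals split.\<close>

lemma insert_pair_cases:
  assumes "p \<in> {1..2 * n + 1}" "j \<in> {1..2 * Suc n}"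
  obtains "j = p" | "j = 2 * Suc n" | j' where "j' \<in> {1..2 * n}" "j = skip p j'"
proof (cases "j \<in> {p, 2 * Suc n}")
  case False
  with assms(2) have "j \<in> skip p ` {1..2 * n}"
    unfolding skip_image[OF assms(1)] by blast
  with that show ?thesis by blast
qed (use that in blast)

section \<open>Fibres and second occurrences\<close>

text \<open>Formulated for any \<open>\<sigma>\<close> that agrees with \<open>\<tau>\<close> along
  \<open>skip p\<close>, so that it serves both the insertion and the deletion of a pair.\<close>

lemma fibre_skip:
  assumes p: "p \<in> {1..2 * n + 1}"
    and \<tau>: "\<And>j. j \<in> {1..2 * n} \<Longrightarrow> \<sigma> (skip p j) = \<tau> j"
    and new: "\<sigma> p \<noteq> i" "\<sigma> (2 * Suc n) \<noteq> i"
  shows "{j \<in> {1..2 * Suc n}. \<sigma> j = i} = skip p ` {j \<in> {1..2 * n}. \<tau> j = i}"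
proof (intro equalityI subsetI)
  fix j assume j: "j \<in> {j \<in> {1..2 * Suc n}. \<sigma> j = i}"
  then have "j \<in> {1..2 * Suc n}" by blast
  then show "j \<in> skip p ` {j \<in> {1..2 * n}. \<tau> j = i}"
    by (rule insert_pair_cases[OF p]) (use j new \<tau> in auto)
next
  fix j assume "j \<in> skip p ` {j \<in> {1..2 * n}. \<tau> j = i}"
  then obtain j' where j': "j' \<in> {1..2 * n}" "\<tau> j' = i" "j = skip p j'" by blast
  then have "j \<in> skip p ` {1..2 * n}" by blast
  then have "j \<in> {1..2 * Suc n}" unfolding skip_image[OF p] by blast
  with j' \<tau> show "j \<in> {j \<in> {1..2 * Suc n}. \<sigma> j = i}" by auto
qed

text \<open>Replaces the \<open>LEAST\<close> by the fibre, so that later arguments only compute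
  two-element sets.\<close>

lemma second_occurrence_eq:
  assumes fib: "{j \<in> {1..2 * n}. \<sigma> j = i} = {a, b}" and "a < b"
  shows "second_occurrence n \<sigma> i = b"
proof -
  have mem: "j \<in> {1..2 * n} \<and> \<sigma> j = i \<longleftrightarrow> j = a \<or> j = b" for j
    using fib by (auto simp: set_eq_iff)
  show ?thesis
    unfolding second_occurrence_def
  proof (rule Least_equality)
    show "b \<in> {1..2 * n} \<and> \<sigma> b = i \<and> (\<exists>k\<in>{1..<b}. \<sigma> k = i)"
      using mem[of a] mem[of b] \<open>a < b\<close> by auto
  next
    fix j assume j: "j \<in> {1..2 * n} \<and> \<sigma> j = i \<and> (\<exists>k\<in>{1..<j}. \<sigma> k = i)"
    then obtain k where k: "1 \<le> k" "k < j" "\<sigma> k = i" by auto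
    with j have "k = a \<or> k = b" using mem[of k] by auto
    with j k mem[of j] show "b \<le> j" using \<open>a < b\<close> by auto
  qed
qed

lemma card_2_less:
  assumes "card (A :: 'a :: linorder set) = 2"
  obtains a b where "A = {a, b}" "a < b"
  using assms unfolding card_2_iff
  by (metis insert_commute linorder_neq_iff)

text \<open>\<open>skip p\<close> is increasing, so it maps the larger element of the fibre to the
  larger element of the image.\<close>

lemma second_occurrence_skip:
  assumes p: "p \<in> {1..2 * n + 1}"
    and fib: "{j \<in> {1..2 * Suc n}. \<sigma> j = i} = skip p ` {j \<in> {1..2 * n}. \<tau> j = i}"
    and card: "card {j \<in> {1..2 * n}. \<tau> j = i} = 2"
  shows "second_occurrence (Suc n) \<sigma> i = skip p (second_occurrence n \<tau> i)"
proof -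
  obtain a b where ab: "{j \<in> {1..2 * n}. \<tau> j = i} = {a, b}" "a < b"
    using card_2_less[OF card] .
  have "second_occurrence (Suc n) \<sigma> i = skip p b"
    by (rule second_occurrence_eq[of _ _ _ "skip p a"]) (use fib ab in auto)
  with second_occurrence_eq[OF ab] show ?thesis by simp
qed

lemma card_skip_image: "card (skip p ` A) = card A"
  by (rule card_image[OF inj_on_subset[OF strict_mono_imp_inj_on[OF strict_mono_skip] subset_UNIV]])

text \<open>\<open>\<tau>\<close> takes values up to \<open>n\<close> only, so no old position
  carries \<open>Suc n\<close>. This also lets \<open>p\<close> be recovered from the long
  deal.\<close>

lemma fibre_insert_pair_new:
  assumes p: "p \<in> {1..2 * n + 1}" and \<tau>: "\<tau> \<in> {1..2 * n} \<rightarrow> {1..n}"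
  shows "{j \<in> {1..2 * Suc n}. insert_pair n \<tau> p j = Suc n} = {p, 2 * Suc n}"
proof (intro equalityI subsetI)
  fix j assume j: "j \<in> {j \<in> {1..2 * Suc n}. insert_pair n \<tau> p j = Suc n}"
  then have "j \<in> {1..2 * Suc n}" by blast
  then show "j \<in> {p, 2 * Suc n}"
  proof (rule insert_pair_cases[OF p])
    fix j' assume "j' \<in> {1..2 * n}" "j = skip p j'"
    with j insert_pair_skip[OF p, of j' \<tau>] funcset_mem[OF \<tau>, of j'] show ?thesis by simp
  qed auto
qed (use p insert_pair_new[OF p] in auto)

lemma second_occurrence_in_fibre:
  assumes "card {j \<in> {1..2 * n}. \<sigma> j = i} = 2"
  shows "second_occurrence n \<sigma> i \<in> {j \<in> {1..2 * n}. \<sigma> j = i}"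
proof -
  obtain a b where ab: "{j \<in> {1..2 * n}. \<sigma> j = i} = {a, b}" "a < b"
    using card_2_less[OF assms] .
  show ?thesis unfolding second_occurrence_eq[OF ab] ab(1) by simp
qed

lemma standard_dealsD:
  assumes "\<sigma> \<in> standard_deals n"
  shows "\<sigma> \<in> {1..2*n} \<rightarrow>\<^sub>E {1..n}"
    and "\<And>i. i \<in> {1..n} \<Longrightarrow> card {j \<in> {1..2 * n}. \<sigma> j = i} = 2"
    and "\<And>i. i \<in> {1..<n} \<Longrightarrow> second_occurrence n \<sigma> i < second_occurrence n \<sigma> (Suc i)"
  using assms by (auto simp: standard_deals_def)

section \<open>Insertion as a bijection onto the deals of the next size\<close>

lemma insert_pair_in_standard_deals:
  assumes \<tau>: "\<tau> \<in> standard_deals n" and p: "p \<in> {1..2 * n + 1}"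
  shows "insert_pair n \<tau> p \<in> standard_deals (Suc n)"
proof -
  let ?\<sigma> = "insert_pair n \<tau> p"
  note \<tau>D = standard_dealsD[OF \<tau>]
  have range: "\<tau> \<in> {1..2 * n} \<rightarrow> {1..n}" using \<tau>D(1) by auto
  have old: "{j \<in> {1..2 * Suc n}. ?\<sigma> j = i} = skip p ` {j \<in> {1..2 * n}. \<tau> j = i}"
    if "i \<in> {1..n}" for i
    using that by (intro fibre_skip[OF p] insert_pair_skip[OF p]) (auto simp: insert_pair_new(1)[OF p] insert_pair_new(2)[OF p, simplified])
  have new: "{j \<in> {1..2 * Suc n}. ?\<sigma> j = Suc n} = {p, 2 * Suc n}"
    by (rule fibre_insert_pair_new[OF p range])
  have second_old: "second_occurrence (Suc n) ?\<sigma> i = skip p (second_occurrence n \<tau> i)"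
    if "i \<in> {1..n}" for i
    using second_occurrence_skip[OF p old[OF that] \<tau>D(2)[OF that]] .
  have second_new: "second_occurrence (Suc n) ?\<sigma> (Suc n) = 2 * Suc n"
    by (rule second_occurrence_eq[OF new]) (use p in auto)
  have "?\<sigma> j \<in> {1..Suc n}" if "j \<in> {1..2 * Suc n}" for j
    using that
  proof (rule insert_pair_cases[OF p])
    fix j' assume j': "j' \<in> {1..2 * n}" "j = skip p j'"
    from funcset_mem[OF range j'(1)] show ?thesis
      unfolding j'(2) insert_pair_skip[OF p j'(1)] by simp
  qed (use insert_pair_new[OF p] in auto)
  then have "?\<sigma> \<in> {1..2 * Suc n} \<rightarrow>\<^sub>E {1..Suc n}"
    by (intro PiE_I) (auto simp: insert_pair_def)
  moreover have "card {j \<in> {1..2 * Suc n}. ?\<sigma> j = i} = 2" if "i \<in> {1..Suc n}" for i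
  proof (cases "i = Suc n")
    case True
    have "p \<noteq> 2 * Suc n" using p by auto
    then show ?thesis unfolding True new by simp
  next
    case False
    with that have "i \<in> {1..n}" by auto
    then show ?thesis unfolding old[OF \<open>i \<in> {1..n}\<close>] card_skip_image by (rule \<tau>D(2))
  qed
  moreover have "second_occurrence (Suc n) ?\<sigma> i < second_occurrence (Suc n) ?\<sigma> (i + 1)"
    if "i \<in> {1..<Suc n}" for i
  proof (cases "i = n")
    case True
    with that have i: "n \<in> {1..n}" by auto
    \<comment> \<open>\<open>skip p\<close> moves this position to at most \<open>2 * n + 1\<close>,
      still before the final one, where \<open>Suc n\<close> occurs for the second time.\<close>
    have "second_occurrence n \<tau> n \<in> {1..2 * n}"
      using second_occurrence_in_fibre[OF \<tau>D(2)[OF i]] by blast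
    then show ?thesis using second_old[OF i] second_new unfolding True by (simp add: skip_def)
  next
    case False
    with that have "i \<in> {1..n}" "Suc i \<in> {1..n}" "i \<in> {1..<n}" by auto
    with \<tau>D(3) show ?thesis by (simp add: second_old)
  qed
  ultimately show ?thesis unfolding standard_deals_def by blast
qed

text \<open>Whatever value \<open>?i\<close> the last position carries, the second occurrence of
  \<open>?i\<close> is there. Second occurrences increase with the value, so that of
  \<open>Suc n\<close> cannot come earlier.\<close>

lemma standard_deals_last:
  assumes \<sigma>: "\<sigma> \<in> standard_deals (Suc n)"
  shows "second_occurrence (Suc n) \<sigma> (Suc n) = 2 * Suc n"
proof -
  note \<sigma>D = standard_dealsD[OF \<sigma>]
  let ?s = "second_occurrence (Suc n) \<sigma>"
  let ?i = "\<sigma> (2 * Suc n)"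
  have i: "?i \<in> {1..Suc n}" using PiE_mem[OF \<sigma>D(1), of "2 * Suc n"] by simp
  have "?i \<le> k \<Longrightarrow> k \<le> Suc n \<Longrightarrow> ?s ?i \<le> ?s k" for k
  proof (induction k rule: dec_induct)
    case (step k)
    with i \<sigma>D(3)[of k] show ?case by simp
  qed simp
  then have mono: "?s ?i \<le> ?s (Suc n)" using i by simp
  obtain a b where ab: "{j \<in> {1..2 * Suc n}. \<sigma> j = ?i} = {a, b}" "a < b"
    using card_2_less[OF \<sigma>D(2)[OF i]] .
  have "2 * Suc n \<in> {j \<in> {1..2 * Suc n}. \<sigma> j = ?i}" by simp
  then have "2 * Suc n \<le> b" unfolding ab(1) using ab(2) by auto
  with mono second_occurrence_eq[OF ab] have "2 * Suc n \<le> ?s (Suc n)" by simp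
  moreover have "?s (Suc n) \<in> {1..2 * Suc n}"
    using second_occurrence_in_fibre[OF \<sigma>D(2)[of "Suc n"]] by simp
  ultimately show ?thesis by simp
qed

text \<open>Surjectivity of the insertion: \<open>p\<close> is the first occurrence of
  \<open>Suc n\<close>, the second is at the end by \<open>standard_deals_last\<close>, and reading
  \<open>\<sigma>\<close> along \<open>skip p\<close> deletes both.\<close>

lemma standard_deals_Suc_cases:
  assumes \<sigma>: "\<sigma> \<in> standard_deals (Suc n)"
  obtains \<tau> p where "\<tau> \<in> standard_deals n" "p \<in> {1..2 * n + 1}" "\<sigma> = insert_pair n \<tau> p"
proof -
  note \<sigma>D = standard_dealsD[OF \<sigma>]
  have "card {j \<in> {1..2 * Suc n}. \<sigma> j = Suc n} = 2" by (rule \<sigma>D(2)) simp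
  then obtain p b where pb: "{j \<in> {1..2 * Suc n}. \<sigma> j = Suc n} = {p, b}" "p < b"
    using card_2_less by metis
  have b: "b = 2 * Suc n"
    using second_occurrence_eq[OF pb] standard_deals_last[OF \<sigma>] by simp
  have "p \<in> {j \<in> {1..2 * Suc n}. \<sigma> j = Suc n}" "b \<in> {j \<in> {1..2 * Suc n}. \<sigma> j = Suc n}"
    using pb(1) by auto
  then have p: "p \<in> {1..2 * n + 1}" and new: "\<sigma> p = Suc n" "\<sigma> (2 * Suc n) = Suc n"
    using pb(2) b by auto
  define \<tau> where "\<tau> = (\<lambda>j\<in>{1..2 * n}. \<sigma> (skip p j))"
  have skip: "\<sigma> (skip p j) = \<tau> j" if "j \<in> {1..2 * n}" for j
    using that by (simp add: \<tau>_def)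
  have fib: "{j \<in> {1..2 * Suc n}. \<sigma> j = i} = skip p ` {j \<in> {1..2 * n}. \<tau> j = i}"
    if "i \<in> {1..n}" for i
    using that by (intro fibre_skip[OF p] skip) (use new in auto)
  have card: "card {j \<in> {1..2 * n}. \<tau> j = i} = 2" if "i \<in> {1..n}" for i
    using \<sigma>D(2)[of i] that unfolding fib[OF that] card_skip_image by simp
  have second: "second_occurrence (Suc n) \<sigma> i = skip p (second_occurrence n \<tau> i)"
    if "i \<in> {1..n}" for i
    by (rule second_occurrence_skip[OF p fib[OF that] card[OF that]])
  have "\<tau> j \<in> {1..n}" if j: "j \<in> {1..2 * n}" for j
  proof -
    have "skip p j \<in> skip p ` {1..2 * n}" using j by blast
    then have "skip p j \<in> {1..2 * Suc n}" "skip p j \<notin> {p, b}"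
      unfolding skip_image[OF p] b by blast+
    \<comment> \<open>Both occurrences of \<open>Suc n\<close> are at positions that the reading
      omits, which lowers the bound on the values to \<open>n\<close>.\<close>
    moreover from this have "\<sigma> (skip p j) \<noteq> Suc n" using pb(1) by blast
    ultimately show ?thesis using PiE_mem[OF \<sigma>D(1)] unfolding skip[OF j, symmetric]
      by (metis atLeastAtMost_iff le_Suc_eq)
  qed
  then have "\<tau> \<in> {1..2 * n} \<rightarrow>\<^sub>E {1..n}" by (intro PiE_I) (auto simp: \<tau>_def)
  moreover have "second_occurrence n \<tau> i < second_occurrence n \<tau> (i + 1)" if "i \<in> {1..<n}" for i
    using \<sigma>D(3)[of i] second[of i] second[of "Suc i"] that by simp
  ultimately have "\<tau> \<in> standard_deals n" using card unfolding standard_deals_def by blast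
  moreover have "\<sigma> = insert_pair n \<tau> p"
  proof
    fix j
    show "\<sigma> j = insert_pair n \<tau> p j"
    proof (cases "j \<in> {1..2 * Suc n}")
      case True
      then show ?thesis
        by (rule insert_pair_cases[OF p])
          (simp_all only: new insert_pair_new[OF p] insert_pair_skip[OF p] skip)
    next
      case False
      \<comment> \<open>Off the interval both sides are \<open>undefined\<close>.\<close>
      then show ?thesis unfolding insert_pair_def using PiE_arb[OF \<sigma>D(1) False] by (simp only: restrict_apply if_False)
    qed
  qed
  ultimately show ?thesis using p that by blast
qed

text \<open>For injectivity, the fibre of \<open>Suc n\<close> is \<open>p\<close> together with the
  last position, which differs from \<open>p\<close>; so it determines \<open>p\<close>, and then
  \<open>\<tau>\<close> is read off along \<open>skip p\<close>.\<close>

lemma bij_betw_insert_pair: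
  "bij_betw (\<lambda>(\<tau>, p). insert_pair n \<tau> p) (standard_deals n \<times> {1..2 * n + 1}) (standard_deals (Suc n))"
proof (rule bij_betwI')
  fix x y
  assume "x \<in> standard_deals n \<times> {1..2 * n + 1}" "y \<in> standard_deals n \<times> {1..2 * n + 1}"
  then obtain \<tau> p \<upsilon> q where xy: "x = (\<tau>, p)" "y = (\<upsilon>, q)"
    and \<tau>: "\<tau> \<in> standard_deals n" and p: "p \<in> {1..2 * n + 1}"
    and \<upsilon>: "\<upsilon> \<in> standard_deals n" and q: "q \<in> {1..2 * n + 1}"
    by auto
  have "\<tau> = \<upsilon> \<and> p = q" if eq: "insert_pair n \<tau> p = insert_pair n \<upsilon> q"
  proof -
    have ranges: "\<tau> \<in> {1..2 * n} \<rightarrow> {1..n}" "\<upsilon> \<in> {1..2 * n} \<rightarrow> {1..n}"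
      using standard_dealsD(1)[OF \<tau>] standard_dealsD(1)[OF \<upsilon>] by auto
    have "{p, 2 * Suc n} = {q, 2 * Suc n}"
      using fibre_insert_pair_new[OF p ranges(1)] fibre_insert_pair_new[OF q ranges(2)] eq by simp
    with p q have pq: "p = q" by (auto simp: doubleton_eq_iff)
    have "\<tau> j = \<upsilon> j" if "j \<in> {1..2 * n}" for j
      using insert_pair_skip[OF p that, of \<tau>] insert_pair_skip[OF q that, of \<upsilon>] eq pq by simp
    then have "\<tau> = \<upsilon>"
      by (rule PiE_ext[OF standard_dealsD(1)[OF \<tau>] standard_dealsD(1)[OF \<upsilon>]])
    with pq show ?thesis by simp
  qed
  then show "((case x of (\<tau>, p) \<Rightarrow> insert_pair n \<tau> p) = (case y of (\<tau>, p) \<Rightarrow> insert_pair n \<tau> p))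
      \<longleftrightarrow> x = y"
    using xy by auto
next
  fix \<sigma> assume "\<sigma> \<in> standard_deals (Suc n)"
  then obtain \<tau> p where "\<tau> \<in> standard_deals n" "p \<in> {1..2 * n + 1}" "\<sigma> = insert_pair n \<tau> p"
    by (rule standard_deals_Suc_cases)
  then show "\<exists>x\<in>standard_deals n \<times> {1..2 * n + 1}. \<sigma> = (case x of (\<tau>, p) \<Rightarrow> insert_pair n \<tau> p)"
    by (intro bexI[of _ "(\<tau>, p)"]) auto
qed (use insert_pair_in_standard_deals in auto)

section \<open>The first match under insertion\<close>

text \<open>For \<open>n \<ge> 1\<close> the value \<open>1\<close> occurs twice, so the
  \<open>LEAST\<close> is attained.\<close>

lemma first_match_is_match:
  assumes \<sigma>: "\<sigma> \<in> standard_deals n" and "n \<ge> 1"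
  shows "first_match n \<sigma> \<in> {1..2 * n} \<and> (\<exists>i\<in>{1..<first_match n \<sigma>}. \<sigma> (first_match n \<sigma>) = \<sigma> i)"
  unfolding first_match_def
proof (rule LeastI_ex)
  have "card {j \<in> {1..2 * n}. \<sigma> j = 1} = 2" using standard_dealsD(2)[OF \<sigma>, of 1] assms(2) by simp
  then obtain a b where ab: "{j \<in> {1..2 * n}. \<sigma> j = 1} = {a, b}" "a < b"
    by (rule card_2_less)
  then have "a \<in> {j \<in> {1..2 * n}. \<sigma> j = 1}" "b \<in> {j \<in> {1..2 * n}. \<sigma> j = 1}" by auto
  with \<open>a < b\<close> show "\<exists>j. j \<in> {1..2 * n} \<and> (\<exists>i\<in>{1..<j}. \<sigma> j = \<sigma> i)"
    by (intro exI[of _ b] conjI bexI[of _ a]) auto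
qed

text \<open>The new pair becomes a match only at the last position, hence never before an old match;
  matches among old positions correspond under \<open>skip p\<close>, which preserves their
  order.\<close>

lemma first_match_insert_pair:
  assumes \<tau>: "\<tau> \<in> standard_deals n" and p: "p \<in> {1..2 * n + 1}" and "n \<ge> 1"
  shows "first_match (Suc n) (insert_pair n \<tau> p) = skip p (first_match n \<tau>)"
proof -
  let ?\<sigma> = "insert_pair n \<tau> p"
  define m where "m = first_match n \<tau>"
  have range: "\<tau> \<in> {1..2 * n} \<rightarrow> {1..n}" using standard_dealsD(1)[OF \<tau>] by auto
  obtain i where m: "m \<in> {1..2 * n}" and i: "i \<in> {1..<m}" "\<tau> m = \<tau> i"
    using first_match_is_match[OF \<tau> \<open>n \<ge> 1\<close>] unfolding m_def by blast
  have new: "j = p \<or> j = 2 * Suc n" if "j \<in> {1..2 * Suc n}" "?\<sigma> j = Suc n" for j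
    using fibre_insert_pair_new[OF p range] that by blast
  have m_le: "skip p m \<le> 2 * Suc n" using m by (auto simp: skip_def)
  have "first_match (Suc n) ?\<sigma> = skip p m"
    unfolding first_match_def
  proof (rule Least_equality)
    have i': "i \<in> {1..2 * n}" using i m by auto
    have "?\<sigma> (skip p m) = ?\<sigma> (skip p i)"
      using insert_pair_skip[OF p m] insert_pair_skip[OF p i'] i(2) by simp
    moreover have "skip p i \<in> {1..<skip p m}"
      using i(1) by (auto simp: skip_def)
    moreover have "skip p m \<in> {1..2 * Suc n}"
      using m by (auto simp: skip_def)
    ultimately show "skip p m \<in> {1..2 * Suc n} \<and> (\<exists>i\<in>{1..<skip p m}. ?\<sigma> (skip p m) = ?\<sigma> i)"
      by blast
  next
    fix k assume "k \<in> {1..2 * Suc n} \<and> (\<exists>l\<in>{1..<k}. ?\<sigma> k = ?\<sigma> l)"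
    then obtain l where k: "k \<in> {1..2 * Suc n}" and l: "l \<in> {1..2 * Suc n}" "l < k" "?\<sigma> k = ?\<sigma> l"
      by auto
    from k show "skip p m \<le> k"
    proof (rule insert_pair_cases[OF p])
      \<comment> \<open>Position \<open>p\<close> completes no match: an earlier position with value
        \<open>Suc n\<close> would be \<open>p\<close> itself or the last one.\<close>
      assume "k = p"
      with l insert_pair_new(1)[OF p, of \<tau>] have "?\<sigma> l = Suc n" by simp
      with new[OF l(1)] l(2) \<open>k = p\<close> p show ?thesis by auto
    next
      assume "k = 2 * Suc n"
      with m_le show ?thesis by simp
    next
      fix k' assume k': "k' \<in> {1..2 * n}" "k = skip p k'"
      \<comment> \<open>The partner \<open>l\<close> carries an old value, so it is an old position
        too; the match pulls back to \<open>\<tau>\<close>, where \<open>m\<close> is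
        minimal.\<close>
      have "\<tau> k' \<noteq> Suc n" using funcset_mem[OF range k'(1)] by auto
      then have ne: "?\<sigma> l \<noteq> Suc n" using l(3) k' insert_pair_skip[OF p k'(1), of \<tau>] by simp
      show ?thesis
        using l(1)
      proof (rule insert_pair_cases[OF p])
        fix l' assume l': "l' \<in> {1..2 * n}" "l = skip p l'"
        then have "\<tau> k' = \<tau> l'" "l' < k'"
          using l(2,3) k' insert_pair_skip[OF p k'(1), of \<tau>] insert_pair_skip[OF p l'(1), of \<tau>]
          by auto
        then have "m \<le> k'"
          unfolding m_def first_match_def using k' l' by (intro Least_le conjI bexI[of _ l']) auto
        with k' show ?thesis by simp
      qed (use ne insert_pair_new[OF p, of \<tau>] in auto)
    qed
  qed
  then show ?thesis unfolding m_def .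
qed

section \<open>The number of deals, the total and the mean\<close>

text \<open>Cleared of denominators to stay in the naturals. The \<open>2 * n + 1\<close> choices of
  \<open>p\<close>, times the factor \<open>2 * n + 2\<close> gained by
  \<open>2 ^ n * fact n\<close>, give the growth of \<open>fact (2 * n)\<close>.\<close>

lemma card_standard_deals: "card (standard_deals n) * (2 ^ n * fact n) = fact (2 * n)"
proof (induction n)
  case 0
  \<comment> \<open>The domain is empty, which leaves one extensional function.\<close>
  have "standard_deals 0 = {\<lambda>_. undefined}" by (auto simp: standard_deals_def)
  then show ?case by simp
next
  case (Suc n)
  have "card (standard_deals (Suc n)) = card (standard_deals n) * (2 * n + 1)"
    using bij_betw_same_card[OF bij_betw_insert_pair[of n]] by (simp add: card_cartesian_product)
  then have "card (standard_deals (Suc n)) * (2 ^ Suc n * fact (Suc n))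
      = (2 * n + 2) * (2 * n + 1) * (card (standard_deals n) * (2 ^ n * fact n))"
    by (simp add: algebra_simps)
  then show ?case unfolding Suc.IH by (simp add: algebra_simps)
qed

text \<open>By \<open>sum_skip\<close>, summing over \<open>p\<close> multiplies the total by
  \<open>2 * Suc n\<close>, the ratio of consecutive values of \<open>2 ^ n * fact n\<close>. The
  induction starts at \<open>1\<close> because the empty deal has no match.\<close>

lemma sum_first_match:
  assumes "n \<ge> 1"
  shows "(\<Sum>\<sigma>\<in>standard_deals n. first_match n \<sigma>) = 2 ^ n * fact n"
  using assms
proof (induction n rule: nat_induct_at_least)
  case base
  \<comment> \<open>A match needs an earlier position, which excludes \<open>1\<close> and leaves
    \<open>2\<close>.\<close>
  have "first_match 1 \<sigma> = 2" if "\<sigma> \<in> standard_deals 1" for \<sigma>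
  proof -
    have "first_match 1 \<sigma> \<in> {1..2 * 1}" "\<exists>i. i \<in> {1..<first_match 1 \<sigma>}"
      using first_match_is_match[OF that] by auto
    then show ?thesis by auto
  qed
  moreover have "card (standard_deals 1) = 1"
    using card_standard_deals[of 1] by simp
  ultimately show ?case by simp
next
  case (Suc n)
  have "(\<Sum>\<sigma>\<in>standard_deals (Suc n). first_match (Suc n) \<sigma>)
      = (\<Sum>(\<tau>, p)\<in>standard_deals n \<times> {1..2 * n + 1}. first_match (Suc n) (insert_pair n \<tau> p))"
    unfolding sum.reindex_bij_betw[OF bij_betw_insert_pair, symmetric] by (simp add: case_prod_beta)
  also have "\<dots> = (\<Sum>\<tau>\<in>standard_deals n. \<Sum>p\<in>{1..2 * n + 1}. skip p (first_match n \<tau>))"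
    unfolding sum.cartesian_product[symmetric]
    using first_match_insert_pair Suc.hyps by (intro sum.cong refl) auto
  also have "\<dots> = (\<Sum>\<tau>\<in>standard_deals n. 2 * Suc n * first_match n \<tau>)"
  proof (intro sum.cong refl sum_skip)
    fix \<tau> assume "\<tau> \<in> standard_deals n"
    then show "first_match n \<tau> \<le> 2 * n + 1"
      using first_match_is_match[of \<tau> n] Suc.hyps by simp
  qed
  also have "\<dots> = 2 * Suc n * (2 ^ n * fact n)"
    unfolding sum_distrib_left[symmetric] Suc.IH ..
  finally show ?case by (simp add: algebra_simps)
qed

theorem theorem5:
  fixes n :: nat
  assumes "n \<ge> 1"
  shows "measure_pmf.expectation (pmf_of_set (standard_deals n)) (\<lambda>\<sigma>. real (first_match n \<sigma>))
           = 2 ^ (2 * n) / real ((2 * n) choose n)"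
proof -
  let ?C = "real (card (standard_deals n))"
  have "?C \<noteq> 0" using finite_standard_deals standard_deals_nonempty by simp
  have card: "?C * (2 ^ n * fact n) = fact (2 * n)"
    using arg_cong[OF card_standard_deals[of n], of real] by simp
  have "measure_pmf.expectation (pmf_of_set (standard_deals n)) (\<lambda>\<sigma>. real (first_match n \<sigma>))
      = real (\<Sum>\<sigma>\<in>standard_deals n. first_match n \<sigma>) / ?C"
    by (simp add: integral_pmf_of_set finite_standard_deals standard_deals_nonempty)
  also have "\<dots> = 2 ^ n * fact n / ?C"
    by (simp add: sum_first_match[OF assms])
  \<comment> \<open>The fraction is expanded by \<open>2 ^ n / fact n\<close>, so that
    \<open>card\<close> applies to the denominator and turns it into the central binomial
    coefficient.\<close>
  also have "\<dots> = 2 ^ (2 * n) / (?C * (2 ^ n * fact n) / (fact n * fact n))"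
    using \<open>?C \<noteq> 0\<close> by (simp add: field_simps flip: power_add mult_2_right)
  also have "\<dots> = 2 ^ (2 * n) / real ((2 * n) choose n)"
    unfolding card by (simp add: binomial_fact)
  finally show ?thesis .
qed

end
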